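(* $\mathcal W\subsetneq\mathcal S$, i.e., $\mathcal W\subseteq\mathcal S$ and there is a process in $\mathcal S$ that is not in $\mathcal W$.
   Context: Session calculus $\pi_{\mathsf S}$. Names (variables) $x,y,z,\dots$; values are names. Processes: $P,Q ::= \overline x\langle v\rangle.P \mid q\,x(y).P$ with $q\in\{\mathsf{lin},\mathsf{un}\}$ (linear/unrestricted input, $y$ bound) $\mid P\mid Q\mid (\nu xy)P$ (restriction binding co-variables $x,y$) $\mid\mathbf 0$. Session types: $T,S ::= \mathbf{end}\mid q\,p\mid a\mid \mu a.T$, $p::= ?T.S\mid !T.S$ (receive/send); recursive types contractive and equi-recursive; only tail-recursive ones are used: server type $\ast?T:=\mu a.\mathsf{un}\,?T.a$ and client type $\ast!T:=\mu a.\mathsf{un}\,!T.a$ ($a$ not in $T$). Duality: $\overline{\mathbf{end}}=\mathbf{end}$, $\overline{q\,p}=q\,\overline p$, $\overline{!T.S}=?T.\overline S$, $\overline{?T.S}=!T.\overline S$, $\overline{\ast?T}=\ast!T$, $\overline{\ast!T}=\ast?T$. $\mathrm{un}(T)$ iff $T=\mathbf{end}$ or $T=\mathsf{un}\,p$; $\mathrm{lin}(T)$ always; $q(\Gamma)$ iff $q(T)$ for every $x:T\in\Gamma$. Split: $\emptyset=\emptyset\circ\emptyset$; given $\Gamma=\Gamma_1\circ\Gamma_2$: if $\mathrm{un}(T)$, $\Gamma,x:T=(\Gamma_1,x:T)\circ(\Gamma_2,x:T)$; $\Gamma,x:\mathsf{lin}\,p=(\Gamma_1,x:\mathsf{lin}\,p)\circ\Gamma_2=\Gamma_1\circ(\Gamma_2,x:\mathsf{lin}\,p)$.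 Update: $\Gamma+x:T=\Gamma,x:T$ if $x\notin\mathrm{dom}(\Gamma)$; $(\Gamma,x:T)+x:T=\Gamma,x:T$ if $\mathrm{un}(T)$. Typing rules: Var: $\mathrm{un}(\Gamma)\Rightarrow\Gamma,x:T\vdash_{\mathsf s}x:T$; Nil: $\mathrm{un}(\Gamma)\Rightarrow\Gamma\vdash_{\mathsf s}\mathbf 0$; Par: $\Gamma_1\vdash_{\mathsf s}P,\Gamma_2\vdash_{\mathsf s}Q\Rightarrow\Gamma_1\circ\Gamma_2\vdash_{\mathsf s}P\mid Q$; Res: $\Gamma,x:T,y:\overline T\vdash_{\mathsf s}P\Rightarrow\Gamma\vdash_{\mathsf s}(\nu xy)P$; In: $q_1(\Gamma_1\circ\Gamma_2)$, $\Gamma_1\vdash_{\mathsf s}x:q_2\,?T.S$, $(\Gamma_2+x:S),y:T\vdash_{\mathsf s}P\Rightarrow\Gamma_1\circ\Gamma_2\vdash_{\mathsf s}q_1\,x(y).P$; Out: $\Gamma_1\vdash_{\mathsf s}x:q\,!T.S$, $\Gamma_2\vdash_{\mathsf s}v:T$, $\Gamma_3+x:S\vdash_{\mathsf s}P\Rightarrow\Gamma_1\circ\Gamma_2\circ\Gamma_3\vdash_{\mathsf s}\overline x\langle v\rangle.P$. $\mathcal S:=\{P\in\pi_{\mathsf S}:\exists\Gamma.\ \Gamma\vdash_{\mathsf s}P\}$. The calculus $\pi_{\mathsf W}$: processes $P ::= \overline{x}\langle y_1,y_2\rangle.P\mid x(y_1,y_2).P\mid\ !x(y_1,y_2).P\mid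 P\mid Q\mid(\nu x)P\mid\mathbf 0$. Types: $V::=\mathsf i^n[V_1,V_2]\mid\mathsf o^n[V_1,V_2]\mid\mathsf S^n[V]\mid\mathsf C^n[V]\mid\mathbf{unit}$ (linear input, linear output, server, client, unit; $n\ge1$ a weight); duality swaps $\mathsf i/\mathsf o$ and $\mathsf S/\mathsf C$ componentwise, $\overline{\mathbf{unit}}=\mathbf{unit}$. Contexts contain $x:V$ or $x::V$ (the latter meaning $x:(V,\overline V)$). $\mathrm{un}$ holds for $\mathsf S^n,\mathsf C^n,\mathbf{unit}$ and for $x::V$ with $\mathrm{un}(V)$. Split: unrestricted entries are copied to both sides; a linear $x:T$ goes to exactly one side; a linear $x::V$ goes entirely to one side or is split as $x:V$ and $x:\overline V$. Level function $l$: names $\to\mathbb N$, $l(x)$ is the weight of $x$'s type (arbitrary for $\mathbf{unit}$). $\mathrm{os}(\overline x\langle\tilde y\rangle.P)=\{x\}\cup\mathrm{os}(P)$, $\mathrm{os}(x(\tilde y).P)=\mathrm{os}(P)$, $\mathrm{os}(P\mid Q)=\mathrm{os}(P)\cup\mathrm{os}(Q)$, $\mathrm{os}((\nu x)P)=\mathrm{os}(P)$, $\mathrm{os}(\mathbf 0)=\mathrm{os}(!x(\tilde y).P)=\emptyset$. Typing rules: Var$_{1,2}$: $\mathrm{un}(\Gamma)\Rightarrow\Gamma,x:V\vdash x:V$ and $\Gamma,x::V\vdash x:V$; Nil: $\mathrm{un}(\Gamma)\Rightarrow\Gamma\vdash\mathbf 0$; Par: $\Gamma_1\vdash P,\Gamma_2\vdash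 Q\Rightarrow\Gamma_1\circ\Gamma_2\vdash P\mid Q$; Res: $\Gamma,x::V\vdash P\Rightarrow\Gamma\vdash(\nu x)P$; Lin-In$_1$: $\Gamma_1,x:\mathsf i^n[V_1,V_2]\vdash x:\mathsf i^n[V_1,V_2]$, $\Gamma_2,y_1:V_1,y_2:V_2\vdash P$, $l(x)=l(y_2)\Rightarrow(\Gamma_1,x:\mathsf i^n[V_1,V_2])\circ\Gamma_2\vdash x(y_1,y_2).P$; Lin-In$_2$: $\Gamma_1,x:\mathsf S^n[V]\vdash x:\mathsf S^n[V]$, $\Gamma_2,x:\mathsf S^n[V],y_1:V,y_2:\mathbf{unit}\vdash P\Rightarrow(\Gamma_1,x:\mathsf S^n[V])\circ(\Gamma_2,x:\mathsf S^n[V])\vdash x(y_1,y_2).P$; Lin-In$_3$: as Lin-In$_2$ with $x::\mathsf S^n[V]$ in a single shared $\Gamma$; Lin-Out: $\Gamma_1,x:\mathsf o^n[V_1,V_2]\vdash x:\mathsf o^n[V_1,V_2]$, $\Gamma_2,y_1:V_1\vdash y_1:V_1$, $\Gamma_3,y_2:V_2\vdash P$, $l(x)=l(y_2)\Rightarrow(\Gamma_1,x:\mathsf o^n[V_1,V_2])\circ(\Gamma_2,y_1:V_1)\circ(\Gamma_3,y_2::V_2)\vdash\overline x\langle y_1,y_2\rangle.P$; Un-Out$_{1,2}$: $\Gamma_1,x\diamond\mathsf C^n[V]\vdash x:\mathsf C^n[V]$, $\Gamma_2,x\diamond\mathsf C^n[V],y_1:V\vdash y_1:V$, $\Gamma_3,x\diamond\mathsf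 C^n[V],y_2:\mathbf{unit}\vdash P\Rightarrow(\Gamma_1,x\diamond\mathsf C^n[V])\circ(\Gamma_2,x\diamond\mathsf C^n[V],y_1:V)\circ(\Gamma_3,x\diamond\mathsf C^n[V])\vdash\overline x\langle y_1,y_2\rangle.P$ with $\diamond\in\{:,::\}$; Un-In$_{1,2}$: $\Gamma,x\diamond\mathsf S^n[V]\vdash x:\mathsf S^n[V]$, $\Gamma,x\diamond\mathsf S^n[V],y_1:V,y_2:\mathbf{unit}\vdash P$, $l(b)<n$ for all $b\in\mathrm{os}(P)\Rightarrow\Gamma,x\diamond\mathsf S^n[V]\vdash\ !x(y_1,y_2).P$. Translation $[\![\cdot]\!]:\pi_{\mathsf S}\to\pi_{\mathsf W}$, relative to the $\pi_{\mathsf S}$ typing (cases by the type of $x$; $z$ fresh): $[\![\mathbf 0]\!]=\mathbf 0$; $[\![P\mid Q]\!]=[\![P]\!]\mid[\![Q]\!]$; $[\![(\nu xy)P]\!]=(\nu z)[\![P\{z/x\}\{z/y\}]\!]$; $[\![\mathsf{lin}\,x(y).P]\!]=x(y,z).[\![P\{z/x\}]\!]$ if $x:\mathsf{lin}\,?T.S$, and $x(y,z).[\![P]\!]$ if $x:\ast?T$; $[\![\mathsf{un}\,x(y).P]\!]=\ !x(y,z).[\![P]\!]$; $[\![\overline x\langle y\rangle.P]\!]=(\nu z)\overline x\langle y,z\rangle.[\![P\{z/x\}]\!]$ if $x:\mathsf{lin}\,!T.S$, and $\overline x\langle y,z\rangle.[\![P]\!]$ if $x:\ast!T$. Types, relative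 to $l$: $[\![\mathbf{end}]\!]^l_x=\mathbf{unit}$; $[\![\mathsf{lin}\,?T.S]\!]^l_x=\mathsf i^{l(x)}[[\![T]\!]^l_\alpha,[\![S]\!]^l_x]$; $[\![\mathsf{lin}\,!T.S]\!]^l_x=\mathsf o^{l(x)}[[\![T]\!]^l_\beta,[\![S]\!]^l_x]$; $[\![\ast?T]\!]^l_x=\mathsf S^{l(x)}[[\![T]\!]^l_\gamma]$; $[\![\ast!T]\!]^l_x=\mathsf C^{l(x)}[[\![T]\!]^l_\gamma]$, with $\alpha,\beta,\gamma$ auxiliary names (the names that occupy the corresponding positions). $[\![x_1:T_1,\dots,x_n:T_n]\!]^l=x_1:[\![T_1]\!]^l_{x_1},\dots,x_n:[\![T_n]\!]^l_{x_n}$. $[\![\Gamma]\!]^l\vdash_{\mathsf w}[\![P]\!]$ means this judgment is derivable in $\pi_{\mathsf W}$ with level function $l$. $\mathcal W:=\{P\in\pi_{\mathsf S}:\exists\Gamma,l.\ \Gamma\vdash_{\mathsf s}P\text{ and }[\![\Gamma]\!]^l\vdash_{\mathsf w}[\![P]\!]\}$. *)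

theory Defs
  imports Main "HOL-Library.Uprod"
begin

type_synonym name = nat


section \<open>The session calculus\<close>

datatype qual = Lin | Unr

datatype sproc =
    SOut name name sproc        \<comment> \<open>output of the second name on the first one\<close>
  | SIn qual name name sproc    \<comment> \<open>\<open>q x(y).P\<close>; binds the second name\<close>
  | SPar sproc sproc
  | SRes name name sproc        \<comment> \<open>binds both co-variables\<close>
  | SNil

primrec sfn :: "sproc \<Rightarrow> name set" where
  "sfn (SOut x v P) = {x, v} \<union> sfn P"
| "sfn (SIn q x y P) = {x} \<union> (sfn P - {y})"
| "sfn (SPar P Q) = sfn P \<union> sfn Q"
| "sfn (SRes x y P) = sfn P - {x, y}"
| "sfn SNil = {}"

primrec snames :: "sproc \<Rightarrow> name set" where
  "snames (SOut x v P) = {x, v} \<union> snames P"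
| "snames (SIn q x y P) = {x, y} \<union> snames P"
| "snames (SPar P Q) = snames P \<union> snames Q"
| "snames (SRes x y P) = {x, y} \<union> snames P"
| "snames SNil = {}"

definition swap_name :: "name \<Rightarrow> name \<Rightarrow> name \<Rightarrow> name" where
  "swap_name a b x = (if x = a then b else if x = b then a else x)"

primrec sswap :: "name \<Rightarrow> name \<Rightarrow> sproc \<Rightarrow> sproc" where
  "sswap a b (SOut x v P) = SOut (swap_name a b x) (swap_name a b v) (sswap a b P)"
| "sswap a b (SIn q x y P) = SIn q (swap_name a b x) (swap_name a b y) (sswap a b P)"
| "sswap a b (SPar P Q) = SPar (sswap a b P) (sswap a b Q)"
| "sswap a b (SRes x y P) = SRes (swap_name a b x) (swap_name a b y) (sswap a b P)"
| "sswap a b SNil = SNil"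

text \<open>Alpha-conversion is the least congruence that renames a bound name to one which is not
  free in its scope. Renaming is expressed by swapping, which never captures. A restriction
  \<open>SRes x x P\<close> is not well formed: its binder cannot be renamed, and it is never typable.\<close>

inductive alpha :: "sproc \<Rightarrow> sproc \<Rightarrow> bool" (infix "\<approx>\<alpha>" 50) where
  alpha_refl: "P \<approx>\<alpha> P"
| alpha_sym: "P \<approx>\<alpha> Q \<Longrightarrow> Q \<approx>\<alpha> P"
| alpha_trans: "P \<approx>\<alpha> Q \<Longrightarrow> Q \<approx>\<alpha> R \<Longrightarrow> P \<approx>\<alpha> R"
| alpha_out: "P \<approx>\<alpha> P' \<Longrightarrow> SOut x v P \<approx>\<alpha> SOut x v P'"
| alpha_in: "P \<approx>\<alpha> P' \<Longrightarrow> SIn q x y P \<approx>\<alpha> SIn q x y P'"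
| alpha_par: "P \<approx>\<alpha> P' \<Longrightarrow> Q \<approx>\<alpha> Q' \<Longrightarrow> SPar P Q \<approx>\<alpha> SPar P' Q'"
| alpha_res: "P \<approx>\<alpha> P' \<Longrightarrow> SRes x y P \<approx>\<alpha> SRes x y P'"
| alpha_in_rename: "z \<notin> sfn P \<Longrightarrow> SIn q x y P \<approx>\<alpha> SIn q x z (sswap y z P)"
| alpha_res_rename1:
    "x \<noteq> y \<Longrightarrow> z \<noteq> y \<Longrightarrow> z \<notin> sfn P \<Longrightarrow> SRes x y P \<approx>\<alpha> SRes z y (sswap x z P)"
| alpha_res_rename2:
    "x \<noteq> y \<Longrightarrow> z \<noteq> x \<Longrightarrow> z \<notin> sfn P \<Longrightarrow> SRes x y P \<approx>\<alpha> SRes x z (sswap y z P)"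


subsection \<open>Session types\<close>

datatype pol = Recv | Send

text \<open>Equi-recursive contractive types are identified with the (possibly infinite) trees they
  unfold to: \<open>Ch q Recv T S\<close> is \<open>q ?T.S\<close> and \<open>Ch q Send T S\<close> is \<open>q !T.S\<close>.\<close>

codatatype sty = End | Ch qual pol sty sty

primrec flip :: "pol \<Rightarrow> pol" where
  "flip Recv = Send"
| "flip Send = Recv"

primcorec sdual :: "sty \<Rightarrow> sty" where
  "sdual T = (case T of End \<Rightarrow> End | Ch q p A S \<Rightarrow> Ch q (flip p) A (sdual S))"

text \<open>\<open>star Recv T\<close> is the server type, i.e.\ the tree of \<open>\<mu>a. un ?T.a\<close>, and \<open>star Send T\<close> is the
  client type.\<close>

primcorec star :: "pol \<Rightarrow> sty \<Rightarrow> sty" where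
  "star p T = Ch Unr p T (star p T)"

lemma sdual_simps:
  "sdual End = End"
  "sdual (Ch q p T S) = Ch q (flip p) T (sdual S)"
  by (subst sdual.code, simp)+

lemma sdual_star: "sdual (star p T) = star (flip p) T"
  by (coinduction rule: sty.coinduct_strong) (auto simp: sty.case_eq_if)

text \<open>The only infinite trees in use are those of server and client types.\<close>

inductive sty_ok :: "sty \<Rightarrow> bool" where
  "sty_ok End"
| "sty_ok T \<Longrightarrow> sty_ok S \<Longrightarrow> sty_ok (Ch q p T S)"
| "sty_ok T \<Longrightarrow> sty_ok (star p T)"

fun qual_ty :: "qual \<Rightarrow> sty \<Rightarrow> bool" where
  "qual_ty Lin T = True"
| "qual_ty Unr T = (T = End \<or> (\<exists>p A S. T = Ch Unr p A S))"

type_synonym sctx = "name \<rightharpoonup> sty"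

definition qual_ctx :: "qual \<Rightarrow> sctx \<Rightarrow> bool" where
  "qual_ctx q \<Gamma> \<longleftrightarrow> (\<forall>x T. \<Gamma> x = Some T \<longrightarrow> qual_ty q T)"

definition sctx_ok :: "sctx \<Rightarrow> bool" where
  "sctx_ok \<Gamma> \<longleftrightarrow> finite (dom \<Gamma>) \<and> (\<forall>x T. \<Gamma> x = Some T \<longrightarrow> sty_ok T)"

inductive ssplit_at :: "sty option \<Rightarrow> sty option \<Rightarrow> sty option \<Rightarrow> bool" where
  "ssplit_at None None None"
| "qual_ty Unr T \<Longrightarrow> ssplit_at (Some T) (Some T) (Some T)"
| "ssplit_at (Some (Ch Lin p T S)) (Some (Ch Lin p T S)) None"
| "ssplit_at (Some (Ch Lin p T S)) None (Some (Ch Lin p T S))"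

text \<open>\<open>ssplit \<Gamma> \<Gamma>1 \<Gamma>2\<close> reads \<open>\<Gamma> = \<Gamma>1 \<circ> \<Gamma>2\<close>.\<close>

definition ssplit :: "sctx \<Rightarrow> sctx \<Rightarrow> sctx \<Rightarrow> bool" where
  "ssplit \<Gamma> \<Gamma>1 \<Gamma>2 \<longleftrightarrow> (\<forall>x. ssplit_at (\<Gamma> x) (\<Gamma>1 x) (\<Gamma>2 x))"

text \<open>\<open>\<Gamma> + x : T\<close> is defined iff \<open>can_update \<Gamma> x T\<close>, and is then \<open>\<Gamma>(x \<mapsto> T)\<close>.\<close>

definition can_update :: "sctx \<Rightarrow> name \<Rightarrow> sty \<Rightarrow> bool" where
  "can_update \<Gamma> x T \<longleftrightarrow> \<Gamma> x = None \<or> \<Gamma> x = Some T \<and> qual_ty Unr T"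

text \<open>In all typing rules below a context \<open>\<Gamma>, x : T\<close> is \<open>\<Gamma>(x \<mapsto> T)\<close> together with
  \<open>x \<notin> dom \<Gamma>\<close>. Requiring well-formed contexts at the leaves of a derivation enforces
  well-formedness of all contexts in it (see \<open>styping_ctx_ok\<close>).\<close>

inductive svar :: "sctx \<Rightarrow> name \<Rightarrow> sty \<Rightarrow> bool" where
  "qual_ctx Unr \<Gamma> \<Longrightarrow> x \<notin> dom \<Gamma> \<Longrightarrow> sctx_ok (\<Gamma>(x \<mapsto> T)) \<Longrightarrow> svar (\<Gamma>(x \<mapsto> T)) x T"

inductive styping :: "sctx \<Rightarrow> sproc \<Rightarrow> bool" ("_ \<turnstile>\<^sub>s _" [51, 51] 50) where
  s_nil: "qual_ctx Unr \<Gamma> \<Longrightarrow> sctx_ok \<Gamma> \<Longrightarrow> \<Gamma> \<turnstile>\<^sub>s SNil"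
| s_par: "\<lbrakk>\<Gamma>1 \<turnstile>\<^sub>s P; \<Gamma>2 \<turnstile>\<^sub>s Q; ssplit \<Gamma> \<Gamma>1 \<Gamma>2\<rbrakk> \<Longrightarrow> \<Gamma> \<turnstile>\<^sub>s SPar P Q"
| s_res: "\<lbrakk>x \<noteq> y; x \<notin> dom \<Gamma>; y \<notin> dom \<Gamma>; \<Gamma>(x \<mapsto> T, y \<mapsto> sdual T) \<turnstile>\<^sub>s P\<rbrakk>
    \<Longrightarrow> \<Gamma> \<turnstile>\<^sub>s SRes x y P"
| s_in: "\<lbrakk>ssplit \<Gamma> \<Gamma>1 \<Gamma>2; qual_ctx q1 \<Gamma>; svar \<Gamma>1 x (Ch q2 Recv T S);
     can_update \<Gamma>2 x S; y \<notin> dom (\<Gamma>2(x \<mapsto> S)); \<Gamma>2(x \<mapsto> S, y \<mapsto> T) \<turnstile>\<^sub>s P\<rbrakk>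
    \<Longrightarrow> \<Gamma> \<turnstile>\<^sub>s SIn q1 x y P"
| s_out: "\<lbrakk>ssplit \<Gamma>12 \<Gamma>1 \<Gamma>2; ssplit \<Gamma> \<Gamma>12 \<Gamma>3; svar \<Gamma>1 x (Ch q Send T S); svar \<Gamma>2 v T;
     can_update \<Gamma>3 x S; \<Gamma>3(x \<mapsto> S) \<turnstile>\<^sub>s P\<rbrakk>
    \<Longrightarrow> \<Gamma> \<turnstile>\<^sub>s SOut x v P"

lemma ssplit_ok: "ssplit G G1 G2 \<Longrightarrow> sctx_ok G1 \<Longrightarrow> sctx_ok G2 \<Longrightarrow> sctx_ok G"
proof -
  assume s: "ssplit G G1 G2" and o: "sctx_ok G1" "sctx_ok G2"
  have *: "G x = G1 x \<or> G x = G2 x" for x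
    using s[unfolded ssplit_def, rule_format, of x] by (auto elim: ssplit_at.cases)
  have "dom G \<subseteq> dom G1 \<union> dom G2" using * by (metis (no_types, lifting) Un_iff domIff subsetI)
  with o * show ?thesis unfolding sctx_ok_def by (metis finite_UnI finite_subset)
qed

lemma sctx_ok_del: "sctx_ok (G(x \<mapsto> T)) \<Longrightarrow> x \<notin> dom G \<Longrightarrow> sctx_ok G"
  unfolding sctx_ok_def by (simp add: domIff split: if_splits) (metis option.distinct(1))

lemma sctx_ok_upd: "sctx_ok (G(x \<mapsto> T)) \<Longrightarrow> can_update G x T \<Longrightarrow> sctx_ok G"
  unfolding can_update_def by (metis sctx_ok_del domIff fun_upd_triv)

lemma svar_ok: "svar G x T \<Longrightarrow> sctx_ok G"
  by (auto elim: svar.cases)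

lemma styping_ctx_ok: "G \<turnstile>\<^sub>s P \<Longrightarrow> sctx_ok G"
proof (induction rule: styping.induct)
  case (s_res x y \<Gamma> T P)
  then have "y \<notin> dom (\<Gamma>(x \<mapsto> T))" by auto
  with s_res show ?case using sctx_ok_del by blast
next
  case (s_in \<Gamma> \<Gamma>1 \<Gamma>2 q1 x q2 T S y P)
  then have "sctx_ok \<Gamma>2" using sctx_ok_del sctx_ok_upd by blast
  with s_in show ?case using svar_ok ssplit_ok by blast
next
  case (s_out \<Gamma>12 \<Gamma>1 \<Gamma>2 \<Gamma> \<Gamma>3 x q T S v P)
  then have "sctx_ok \<Gamma>3" using sctx_ok_upd by blast
  with s_out show ?case using svar_ok ssplit_ok by blast
qed (auto intro: ssplit_ok)


section \<open>The calculus with weights\<close>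

datatype wproc =
    WOut name name name wproc
  | WIn name name name wproc      \<comment> \<open>\<open>x(y1,y2).P\<close>\<close>
  | WRep name name name wproc     \<comment> \<open>\<open>!x(y1,y2).P\<close>\<close>
  | WPar wproc wproc
  | WRes name wproc
  | WNil

primrec wnames :: "wproc \<Rightarrow> name set" where
  "wnames (WOut x y1 y2 P) = {x, y1, y2} \<union> wnames P"
| "wnames (WIn x y1 y2 P) = {x, y1, y2} \<union> wnames P"
| "wnames (WRep x y1 y2 P) = {x, y1, y2} \<union> wnames P"
| "wnames (WPar P Q) = wnames P \<union> wnames Q"
| "wnames (WRes x P) = {x} \<union> wnames P"
| "wnames WNil = {}"

definition ren :: "name \<Rightarrow> name \<Rightarrow> name \<Rightarrow> name" where
  "ren z x u = (if u = x then z else u)"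

text \<open>\<open>wsubst z x P\<close> is \<open>P{z/x}\<close>. It is only used when \<open>z\<close> is not bound in \<open>P\<close>, so that no
  capture can occur.\<close>

primrec wsubst :: "name \<Rightarrow> name \<Rightarrow> wproc \<Rightarrow> wproc" where
  "wsubst z x (WOut u y1 y2 P) = WOut (ren z x u) (ren z x y1) (ren z x y2) (wsubst z x P)"
| "wsubst z x (WIn u y1 y2 P) =
     WIn (ren z x u) y1 y2 (if x \<in> {y1, y2} then P else wsubst z x P)"
| "wsubst z x (WRep u y1 y2 P) =
     WRep (ren z x u) y1 y2 (if x \<in> {y1, y2} then P else wsubst z x P)"
| "wsubst z x (WPar P Q) = WPar (wsubst z x P) (wsubst z x Q)"
| "wsubst z x (WRes u P) = WRes u (if x = u then P else wsubst z x P)"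
| "wsubst z x WNil = WNil"

primrec os :: "wproc \<Rightarrow> name set" where
  "os (WOut x y1 y2 P) = {x} \<union> os P"
| "os (WIn x y1 y2 P) = os P"
| "os (WRep x y1 y2 P) = {}"
| "os (WPar P Q) = os P \<union> os Q"
| "os (WRes x P) = os P"
| "os WNil = {}"

datatype wty =
    LIn nat wty wty
  | LOut nat wty wty
  | Srv nat wty
  | Cli nat wty
  | Unit

text \<open>As for session types, the payload is not dualised: the payload of an output and that of the
  matching input have the same type.\<close>

primrec wdual :: "wty \<Rightarrow> wty" where
  "wdual (LIn n V1 V2) = LOut n V1 (wdual V2)"
| "wdual (LOut n V1 V2) = LIn n V1 (wdual V2)"
| "wdual (Srv n V) = Cli n V"
| "wdual (Cli n V) = Srv n V"
| "wdual Unit = Unit"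

lemma wdual_wdual [simp]: "wdual (wdual V) = V"
  by (induction V) auto

primrec weights_pos :: "wty \<Rightarrow> bool" where
  "weights_pos (LIn n V1 V2) \<longleftrightarrow> n \<ge> 1 \<and> weights_pos V1 \<and> weights_pos V2"
| "weights_pos (LOut n V1 V2) \<longleftrightarrow> n \<ge> 1 \<and> weights_pos V1 \<and> weights_pos V2"
| "weights_pos (Srv n V) \<longleftrightarrow> n \<ge> 1 \<and> weights_pos V"
| "weights_pos (Cli n V) \<longleftrightarrow> n \<ge> 1 \<and> weights_pos V"
| "weights_pos Unit \<longleftrightarrow> True"

primrec has_weight :: "wty \<Rightarrow> nat \<Rightarrow> bool" where
  "has_weight (LIn n V1 V2) m \<longleftrightarrow> m = n"
| "has_weight (LOut n V1 V2) m \<longleftrightarrow> m = n"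
| "has_weight (Srv n V) m \<longleftrightarrow> m = n"
| "has_weight (Cli n V) m \<longleftrightarrow> m = n"
| "has_weight Unit m \<longleftrightarrow> True"

primrec wun :: "wty \<Rightarrow> bool" where
  "wun (LIn n V1 V2) \<longleftrightarrow> False"
| "wun (LOut n V1 V2) \<longleftrightarrow> False"
| "wun (Srv n V) \<longleftrightarrow> True"
| "wun (Cli n V) \<longleftrightarrow> True"
| "wun Unit \<longleftrightarrow> True"

text \<open>\<open>One V\<close> is the entry of \<open>x : V\<close> and \<open>both V\<close> is the entry of \<open>x :: V\<close>. The pair of a type and
  its dual is unordered: since unrestricted entries are copied when splitting, the entries
  \<open>x :: Srv n V\<close> used by a server and \<open>x :: Cli n V\<close> used by its clients must be the same.\<close>

datatype entry = One wty | Two "wty uprod"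

definition both :: "wty \<Rightarrow> entry" where
  "both V = Two (Upair V (wdual V))"

primrec un_entry :: "entry \<Rightarrow> bool" where
  "un_entry (One V) \<longleftrightarrow> wun V"
| "un_entry (Two U) \<longleftrightarrow> (\<forall>V \<in> set_uprod U. wun V)"

type_synonym wctx = "name \<rightharpoonup> entry"

definition un_wctx :: "wctx \<Rightarrow> bool" where
  "un_wctx \<Gamma> \<longleftrightarrow> (\<forall>x e. \<Gamma> x = Some e \<longrightarrow> un_entry e)"

text \<open>The level function assigns to each name the weight of its type. As for session contexts, this
  is required at the leaves of a derivation and thus holds for all its contexts
  (see \<open>wtyping_ctx_ok\<close>).\<close>

definition wctx_ok :: "(name \<Rightarrow> nat) \<Rightarrow> wctx \<Rightarrow> bool" where
  "wctx_ok l \<Gamma> \<longleftrightarrow> finite (dom \<Gamma>) \<and>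
     (\<forall>x e. \<Gamma> x = Some e \<longrightarrow>
        (\<exists>V. (e = One V \<or> e = both V) \<and> weights_pos V \<and> has_weight V (l x)))"

inductive wsplit_at :: "entry option \<Rightarrow> entry option \<Rightarrow> entry option \<Rightarrow> bool" where
  "wsplit_at None None None"
| "un_entry e \<Longrightarrow> wsplit_at (Some e) (Some e) (Some e)"
| "\<not> un_entry e \<Longrightarrow> wsplit_at (Some e) (Some e) None"
| "\<not> un_entry e \<Longrightarrow> wsplit_at (Some e) None (Some e)"
| "\<not> un_entry (both V) \<Longrightarrow> wsplit_at (Some (both V)) (Some (One V)) (Some (One (wdual V)))"

definition wsplit :: "wctx \<Rightarrow> wctx \<Rightarrow> wctx \<Rightarrow> bool" where
  "wsplit \<Gamma> \<Gamma>1 \<Gamma>2 \<longleftrightarrow> (\<forall>x. wsplit_at (\<Gamma> x) (\<Gamma>1 x) (\<Gamma>2 x))"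

inductive wvar :: "(name \<Rightarrow> nat) \<Rightarrow> wctx \<Rightarrow> name \<Rightarrow> wty \<Rightarrow> bool" for l where
  wvar1: "\<lbrakk>un_wctx \<Gamma>; x \<notin> dom \<Gamma>; wctx_ok l (\<Gamma>(x \<mapsto> One V))\<rbrakk> \<Longrightarrow> wvar l (\<Gamma>(x \<mapsto> One V)) x V"
| wvar2: "\<lbrakk>un_wctx \<Gamma>; x \<notin> dom \<Gamma>; wctx_ok l (\<Gamma>(x \<mapsto> both V))\<rbrakk> \<Longrightarrow> wvar l (\<Gamma>(x \<mapsto> both V)) x V"

text \<open>In \<open>w_un_out\<close> the object \<open>y2\<close> is a dummy of type \<open>Unit\<close> that is not part of the context of the
  conclusion; the translation below leaves it free.\<close>

inductive wtyping :: "(name \<Rightarrow> nat) \<Rightarrow> wctx \<Rightarrow> wproc \<Rightarrow> bool" for l where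
  w_nil: "\<lbrakk>un_wctx \<Gamma>; wctx_ok l \<Gamma>\<rbrakk> \<Longrightarrow> wtyping l \<Gamma> WNil"
| w_par: "\<lbrakk>wtyping l \<Gamma>1 P; wtyping l \<Gamma>2 Q; wsplit \<Gamma> \<Gamma>1 \<Gamma>2\<rbrakk> \<Longrightarrow> wtyping l \<Gamma> (WPar P Q)"
| w_res: "\<lbrakk>x \<notin> dom \<Gamma>; wtyping l (\<Gamma>(x \<mapsto> both V)) P\<rbrakk> \<Longrightarrow> wtyping l \<Gamma> (WRes x P)"
| w_lin_in1: "\<lbrakk>x \<notin> dom \<Gamma>1; wvar l (\<Gamma>1(x \<mapsto> One (LIn n V1 V2))) x (LIn n V1 V2);
     y1 \<notin> dom \<Gamma>2; y2 \<notin> dom \<Gamma>2; y1 \<noteq> y2;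
     wtyping l (\<Gamma>2(y1 \<mapsto> One V1, y2 \<mapsto> One V2)) P; l x = l y2;
     wsplit \<Gamma> (\<Gamma>1(x \<mapsto> One (LIn n V1 V2))) \<Gamma>2\<rbrakk>
    \<Longrightarrow> wtyping l \<Gamma> (WIn x y1 y2 P)"
| w_lin_in2: "\<lbrakk>x \<notin> dom \<Gamma>1; wvar l (\<Gamma>1(x \<mapsto> One (Srv n V))) x (Srv n V);
     x \<notin> dom \<Gamma>2; y1 \<notin> dom \<Gamma>2; y2 \<notin> dom \<Gamma>2; distinct [x, y1, y2];
     wtyping l (\<Gamma>2(x \<mapsto> One (Srv n V), y1 \<mapsto> One V, y2 \<mapsto> One Unit)) P;
     wsplit \<Gamma> (\<Gamma>1(x \<mapsto> One (Srv n V))) (\<Gamma>2(x \<mapsto> One (Srv n V)))\<rbrakk>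
    \<Longrightarrow> wtyping l \<Gamma> (WIn x y1 y2 P)"
| w_lin_in3: "\<lbrakk>x \<notin> dom \<Gamma>; wvar l (\<Gamma>(x \<mapsto> both (Srv n V))) x (Srv n V);
     y1 \<notin> dom \<Gamma>; y2 \<notin> dom \<Gamma>; distinct [x, y1, y2];
     wtyping l (\<Gamma>(x \<mapsto> both (Srv n V), y1 \<mapsto> One V, y2 \<mapsto> One Unit)) P\<rbrakk>
    \<Longrightarrow> wtyping l (\<Gamma>(x \<mapsto> both (Srv n V))) (WIn x y1 y2 P)"
| w_lin_out: "\<lbrakk>x \<notin> dom \<Gamma>1; wvar l (\<Gamma>1(x \<mapsto> One (LOut n V1 V2))) x (LOut n V1 V2);
     y1 \<notin> dom \<Gamma>2; wvar l (\<Gamma>2(y1 \<mapsto> One V1)) y1 V1;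
     y2 \<notin> dom \<Gamma>3; wtyping l (\<Gamma>3(y2 \<mapsto> One V2)) P; l x = l y2;
     wsplit \<Gamma>12 (\<Gamma>1(x \<mapsto> One (LOut n V1 V2))) (\<Gamma>2(y1 \<mapsto> One V1));
     wsplit \<Gamma> \<Gamma>12 (\<Gamma>3(y2 \<mapsto> both V2))\<rbrakk>
    \<Longrightarrow> wtyping l \<Gamma> (WOut x y1 y2 P)"
| w_un_out: "\<lbrakk>e = One (Cli n V) \<or> e = both (Cli n V);
     x \<notin> dom \<Gamma>1; wvar l (\<Gamma>1(x \<mapsto> e)) x (Cli n V);
     x \<notin> dom \<Gamma>2; y1 \<notin> dom \<Gamma>2; x \<noteq> y1; wvar l (\<Gamma>2(x \<mapsto> e, y1 \<mapsto> One V)) y1 V;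
     x \<notin> dom \<Gamma>3; y2 \<notin> dom \<Gamma>3; x \<noteq> y2; wtyping l (\<Gamma>3(x \<mapsto> e, y2 \<mapsto> One Unit)) P;
     wsplit \<Gamma>12 (\<Gamma>1(x \<mapsto> e)) (\<Gamma>2(x \<mapsto> e, y1 \<mapsto> One V));
     wsplit \<Gamma> \<Gamma>12 (\<Gamma>3(x \<mapsto> e))\<rbrakk>
    \<Longrightarrow> wtyping l \<Gamma> (WOut x y1 y2 P)"
| w_un_in: "\<lbrakk>e = One (Srv n V) \<or> e = both (Srv n V);
     x \<notin> dom \<Gamma>; wvar l (\<Gamma>(x \<mapsto> e)) x (Srv n V);
     y1 \<notin> dom \<Gamma>; y2 \<notin> dom \<Gamma>; distinct [x, y1, y2];
     wtyping l (\<Gamma>(x \<mapsto> e, y1 \<mapsto> One V, y2 \<mapsto> One Unit)) P;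
     \<forall>b \<in> os P. l b < n\<rbrakk>
    \<Longrightarrow> wtyping l (\<Gamma>(x \<mapsto> e)) (WRep x y1 y2 P)"

lemma wsplit_ok:
  assumes s: "wsplit \<Gamma> \<Gamma>1 \<Gamma>2" and o: "wctx_ok l \<Gamma>1" "wctx_ok l \<Gamma>2"
  shows "wctx_ok l \<Gamma>"
proof -
  have *: "\<Gamma> x = \<Gamma>1 x \<or> \<Gamma> x = \<Gamma>2 x \<or> (\<exists>V. \<Gamma> x = Some (both V) \<and> \<Gamma>1 x = Some (One V))" for x
    using s[unfolded wsplit_def, rule_format, of x] by (rule wsplit_at.cases) simp_all
  have "dom \<Gamma> \<subseteq> dom \<Gamma>1 \<union> dom \<Gamma>2"
  proof
    fix x
    assume "x \<in> dom \<Gamma>"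
    then show "x \<in> dom \<Gamma>1 \<union> dom \<Gamma>2" using *[of x] by auto
  qed
  then have "finite (dom \<Gamma>)"
    using o unfolding wctx_ok_def by (meson finite_UnI finite_subset)
  moreover have "\<exists>V. (e = One V \<or> e = both V) \<and> weights_pos V \<and> has_weight V (l x)"
    if e: "\<Gamma> x = Some e" for x e
  proof -
    consider "\<Gamma>1 x = Some e" | "\<Gamma>2 x = Some e" | V where "e = both V" "\<Gamma>1 x = Some (One V)"
      using *[of x] unfolding e by (elim disjE) auto
    then show ?thesis
    proof cases
      case 1
      then show ?thesis using o(1) unfolding wctx_ok_def by blast
    next
      case 2
      then show ?thesis using o(2) unfolding wctx_ok_def by blast
    next
      case (3 V)
      then obtain W where "One V = One W \<or> One V = both W" "weights_pos W" "has_weight W (l x)"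
        using o(1) unfolding wctx_ok_def by blast
      then have "weights_pos V" "has_weight V (l x)" by (simp_all add: both_def)
      with 3(1) show ?thesis by (intro exI[of _ V]) simp
    qed
  qed
  ultimately show ?thesis unfolding wctx_ok_def by blast
qed

lemma wctx_ok_del:
  assumes "wctx_ok l (\<Gamma>(x \<mapsto> e'))" "x \<notin> dom \<Gamma>"
  shows "wctx_ok l \<Gamma>"
proof -
  have "(\<Gamma>(x \<mapsto> e')) u = Some e" if "\<Gamma> u = Some e" for u e
    using that assms(2) by auto
  moreover have "finite (dom \<Gamma>)" using assms by (simp add: wctx_ok_def)
  ultimately show ?thesis using assms(1) unfolding wctx_ok_def by blast
qed

lemma wctx_ok_both:
  assumes "wctx_ok l (\<Gamma>(x \<mapsto> One V))"
  shows "wctx_ok l (\<Gamma>(x \<mapsto> both V))"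
proof -
  obtain W where "One V = One W \<or> One V = both W" "weights_pos W" "has_weight W (l x)"
    using assms unfolding wctx_ok_def by (metis fun_upd_same)
  then have V: "weights_pos V" "has_weight V (l x)" by (simp_all add: both_def)
  have "\<exists>V. (e = One V \<or> e = both V) \<and> weights_pos V \<and> has_weight V (l u)"
    if "(\<Gamma>(x \<mapsto> both V)) u = Some e" for u e
  proof (cases "u = x")
    case True
    with that have "e = both V" by simp
    with V True show ?thesis by (intro exI[of _ V]) simp
  next
    case False
    with that have "(\<Gamma>(x \<mapsto> One V)) u = Some e" by simp
    then show ?thesis using assms unfolding wctx_ok_def by blast
  qed
  moreover have "finite (dom (\<Gamma>(x \<mapsto> both V)))" using assms by (simp add: wctx_ok_def)
  ultimately show ?thesis unfolding wctx_ok_def by blast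
qed

lemma wvar_ok: "wvar l G x V \<Longrightarrow> wctx_ok l G" by (auto elim: wvar.cases)

lemma wtyping_ctx_ok: "wtyping l G P \<Longrightarrow> wctx_ok l G"
proof (induction rule: wtyping.induct)
  case (w_lin_in1 x \<Gamma>1 n V1 V2 y1 \<Gamma>2 y2 P \<Gamma>)
  from w_lin_in1 have "y2 \<notin> dom (\<Gamma>2(y1 \<mapsto> One V1))" by auto
  then have "wctx_ok l \<Gamma>2" using w_lin_in1 wctx_ok_del by blast
  then show ?case
    by (rule wsplit_ok[OF w_lin_in1.hyps(8) wvar_ok[OF w_lin_in1.hyps(2)]])
next
  case (w_lin_in2 x \<Gamma>1 n V \<Gamma>2 y1 y2 P \<Gamma>)
  from w_lin_in2 have "y1 \<notin> dom (\<Gamma>2(x \<mapsto> One (Srv n V)))"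
    "y2 \<notin> dom (\<Gamma>2(x \<mapsto> One (Srv n V), y1 \<mapsto> One V))" by auto
  then have "wctx_ok l (\<Gamma>2(x \<mapsto> One (Srv n V)))" using w_lin_in2 wctx_ok_del by blast
  then show ?case
    by (rule wsplit_ok[OF w_lin_in2.hyps(8) wvar_ok[OF w_lin_in2.hyps(2)]])
next
  case (w_lin_out x \<Gamma>1 n V1 V2 y1 \<Gamma>2 y2 \<Gamma>3 P \<Gamma>12 \<Gamma>)
  then have "wctx_ok l (\<Gamma>3(y2 \<mapsto> both V2))" by (intro wctx_ok_both)
  moreover have "wctx_ok l \<Gamma>12"
    by (rule wsplit_ok[OF w_lin_out.hyps(8) wvar_ok[OF w_lin_out.hyps(2)] wvar_ok[OF w_lin_out.hyps(4)]])
  ultimately show ?case using wsplit_ok w_lin_out.hyps(9) by blast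
next
  case (w_un_out e n V x \<Gamma>1 \<Gamma>2 y1 \<Gamma>3 y2 P \<Gamma>12 \<Gamma>)
  from w_un_out have "y2 \<notin> dom (\<Gamma>3(x \<mapsto> e))" by auto
  then have "wctx_ok l (\<Gamma>3(x \<mapsto> e))" using w_un_out wctx_ok_del by blast
  moreover have "wctx_ok l \<Gamma>12"
    by (rule wsplit_ok[OF w_un_out.hyps(12) wvar_ok[OF w_un_out.hyps(3)] wvar_ok[OF w_un_out.hyps(7)]])
  ultimately show ?case using wsplit_ok w_un_out.hyps(13) by blast
next
  case w_un_in
  then show ?case using wvar_ok by blast
next
  case w_lin_in3
  then show ?case using wvar_ok by blast
next
  case w_res
  then show ?case using wctx_ok_del by blast
qed (auto intro: wsplit_ok)


section \<open>The translation\<close>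

text \<open>\<open>transl N \<Gamma> P Q\<close>: the session typing derivation of \<open>\<Gamma> \<turnstile>\<^sub>s P\<close> with the same rule structure
  translates \<open>P\<close> to \<open>Q\<close>. The translation goes by recursion on the derivation, because the types of
  restricted names are not recorded in processes. Fresh names avoid the translated subprocess and
  a fixed set \<open>N\<close> that is to contain all names of the whole source process and of its context.

  The substitutions are performed on the translated subprocess, i.e.\ the translation of a
  subprocess \<open>P{z/x}\<close> is that of \<open>P\<close> followed by replacing \<open>x\<close> by \<open>z\<close>. In the case of a restriction this
  keeps apart the types of the co-variables, on which the translation of \<open>P\<close> depends.\<close>

inductive transl :: "name set \<Rightarrow> sctx \<Rightarrow> sproc \<Rightarrow> wproc \<Rightarrow> bool" for N where
  t_nil: "qual_ctx Unr \<Gamma> \<Longrightarrow> sctx_ok \<Gamma> \<Longrightarrow> transl N \<Gamma> SNil WNil"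
| t_par: "\<lbrakk>transl N \<Gamma>1 P P'; transl N \<Gamma>2 Q Q'; ssplit \<Gamma> \<Gamma>1 \<Gamma>2\<rbrakk>
    \<Longrightarrow> transl N \<Gamma> (SPar P Q) (WPar P' Q')"
| t_res: "\<lbrakk>x \<noteq> y; x \<notin> dom \<Gamma>; y \<notin> dom \<Gamma>; transl N (\<Gamma>(x \<mapsto> T, y \<mapsto> sdual T)) P P';
     z \<notin> N \<union> wnames P'\<rbrakk>
    \<Longrightarrow> transl N \<Gamma> (SRes x y P) (WRes z (wsubst z y (wsubst z x P')))"
| t_lin_in_lin: "\<lbrakk>ssplit \<Gamma> \<Gamma>1 \<Gamma>2; svar \<Gamma>1 x (Ch Lin Recv T S);
     can_update \<Gamma>2 x S; y \<notin> dom (\<Gamma>2(x \<mapsto> S)); transl N (\<Gamma>2(x \<mapsto> S, y \<mapsto> T)) P P';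
     z \<notin> N \<union> wnames P'\<rbrakk>
    \<Longrightarrow> transl N \<Gamma> (SIn Lin x y P) (WIn x y z (wsubst z x P'))"
| t_lin_in_star: "\<lbrakk>ssplit \<Gamma> \<Gamma>1 \<Gamma>2; svar \<Gamma>1 x (star Recv T);
     can_update \<Gamma>2 x (star Recv T); y \<notin> dom (\<Gamma>2(x \<mapsto> star Recv T));
     transl N (\<Gamma>2(x \<mapsto> star Recv T, y \<mapsto> T)) P P'; z \<notin> N \<union> wnames P'\<rbrakk>
    \<Longrightarrow> transl N \<Gamma> (SIn Lin x y P) (WIn x y z P')"
| t_un_in: "\<lbrakk>ssplit \<Gamma> \<Gamma>1 \<Gamma>2; qual_ctx Unr \<Gamma>; svar \<Gamma>1 x (Ch q Recv T S);
     can_update \<Gamma>2 x S; y \<notin> dom (\<Gamma>2(x \<mapsto> S)); transl N (\<Gamma>2(x \<mapsto> S, y \<mapsto> T)) P P';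
     z \<notin> N \<union> wnames P'\<rbrakk>
    \<Longrightarrow> transl N \<Gamma> (SIn Unr x y P) (WRep x y z P')"
| t_out_lin: "\<lbrakk>ssplit \<Gamma>12 \<Gamma>1 \<Gamma>2; ssplit \<Gamma> \<Gamma>12 \<Gamma>3; svar \<Gamma>1 x (Ch Lin Send T S); svar \<Gamma>2 v T;
     can_update \<Gamma>3 x S; transl N (\<Gamma>3(x \<mapsto> S)) P P'; z \<notin> N \<union> wnames P'\<rbrakk>
    \<Longrightarrow> transl N \<Gamma> (SOut x v P) (WRes z (WOut x v z (wsubst z x P')))"
| t_out_star: "\<lbrakk>ssplit \<Gamma>12 \<Gamma>1 \<Gamma>2; ssplit \<Gamma> \<Gamma>12 \<Gamma>3; svar \<Gamma>1 x (star Send T); svar \<Gamma>2 v T;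
     can_update \<Gamma>3 x (star Send T); transl N (\<Gamma>3(x \<mapsto> star Send T)) P P'; z \<notin> N \<union> wnames P'\<rbrakk>
    \<Longrightarrow> transl N \<Gamma> (SOut x v P) (WOut x v z P')"

text \<open>The derivations that are translated are exactly those of the type system.\<close>

lemma finite_wnames: "finite (wnames Q)" by (induction Q) auto

lemma star_uniq: "S = Ch Unr p T S \<Longrightarrow> S = star p T"
proof (coinduction arbitrary: S rule: sty.coinduct_strong)
  case (Eq_sty S)
  then show ?case by (metis star.code sty.distinct(1) sty.sel)
qed

lemma split_star: assumes "ssplit G G1 G2" "svar G1 x (Ch Unr p T S)" "can_update G2 x S"
  shows "S = star p T"
proof -
  have "G1 x = Some (Ch Unr p T S)" using assms(2) by (auto elim!: svar.cases)
  moreover have "ssplit_at (G x) (G1 x) (G2 x)" using assms(1) by (auto simp: ssplit_def)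
  ultimately have "G2 x = Some (Ch Unr p T S)" by (auto elim: ssplit_at.cases)
  with assms(3) have S: "S = Ch Unr p T S" by (auto simp: can_update_def)
  then show ?thesis by (rule star_uniq)
qed

lemma star_code': "Ch Unr p T (star p T) = star p T" by (rule star.code[symmetric])

lemma fresh_ex: "finite N \<Longrightarrow> \<exists>z. z \<notin> N \<union> wnames Q"
  by (metis ex_new_if_finite finite_UnI finite_wnames infinite_UNIV_nat)

lemma transl_total: "\<Gamma> \<turnstile>\<^sub>s P \<Longrightarrow> finite N \<Longrightarrow> \<exists>Q. transl N \<Gamma> P Q"
proof (induction rule: styping.induct)
  case s_nil
  then show ?case by (blast intro: t_nil)
next
  case s_par
  then show ?case by (blast intro: t_par)
next
  case (s_res x y \<Gamma> T P)
  then obtain Q where Q: "transl N (\<Gamma>(x \<mapsto> T, y \<mapsto> sdual T)) P Q" by blast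
  obtain z where "z \<notin> N \<union> wnames Q" using fresh_ex s_res.prems by blast
  from t_res[OF s_res.hyps(1-3) Q this] show ?case by blast
next
  case (s_in \<Gamma> \<Gamma>1 \<Gamma>2 q1 x q2 T S y P)
  then obtain Q where Q: "transl N (\<Gamma>2(x \<mapsto> S, y \<mapsto> T)) P Q" by blast
  obtain z where z: "z \<notin> N \<union> wnames Q" using fresh_ex s_in.prems by blast
  note h = s_in.hyps
  show ?case
  proof (cases q1)
    case Unr
    from t_un_in[OF h(1) h(2)[unfolded Unr] h(3-5) Q z] Unr show ?thesis by blast
  next
    case q1: Lin
    show ?thesis
    proof (cases q2)
      case Lin
      from t_lin_in_lin[OF h(1) h(3)[unfolded Lin] h(4,5) Q z] q1 show ?thesis by blast
    next
      case Unr
      have S: "S = star Recv T" using split_star[OF h(1) h(3)[unfolded Unr] h(4)] .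
      from t_lin_in_star[OF h(1) h(3)[unfolded Unr S star_code'] h(4,5)[unfolded S] Q[unfolded S] z] q1
      show ?thesis by blast
    qed
  qed
next
  case (s_out \<Gamma>12 \<Gamma>1 \<Gamma>2 \<Gamma> \<Gamma>3 x q T S v P)
  then obtain Q where Q: "transl N (\<Gamma>3(x \<mapsto> S)) P Q" by blast
  obtain z where z: "z \<notin> N \<union> wnames Q" using fresh_ex s_out.prems by blast
  note h = s_out.hyps
  show ?case
  proof (cases q)
    case Lin
    from t_out_lin[OF h(1,2) h(3)[unfolded Lin] h(4,5) Q z] show ?thesis by blast
  next
    case Unr
    have 1: "\<Gamma>1 x = Some (Ch Unr Send T S)" using h(3) Unr by (auto elim!: svar.cases)
    have "ssplit_at (\<Gamma>12 x) (\<Gamma>1 x) (\<Gamma>2 x)" "ssplit_at (\<Gamma> x) (\<Gamma>12 x) (\<Gamma>3 x)"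
      using h by (auto simp: ssplit_def)
    with 1 have "\<Gamma>3 x = Some (Ch Unr Send T S)" by (auto elim!: ssplit_at.cases)
    with h(5) have "S = Ch Unr Send T S" by (auto simp: can_update_def)
    then have S: "S = star Send T" by (rule star_uniq)
    from t_out_star[OF h(1,2) h(3)[unfolded Unr S star_code'] h(4) h(5)[unfolded S] Q[unfolded S] z]
    show ?thesis by blast
  qed
qed

lemma transl_typing: "transl N G P Q \<Longrightarrow> G \<turnstile>\<^sub>s P"
proof (induction rule: transl.induct)
  case t_nil
  then show ?case by (rule s_nil)
next
  case t_par
  then show ?case by (intro s_par)
next
  case t_res
  then show ?case by (intro s_res)
next
  case (t_lin_in_lin \<Gamma> \<Gamma>1 \<Gamma>2 x T S y P P' z)
  have "qual_ctx Lin \<Gamma>" by (simp add: qual_ctx_def)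
  then show ?case using t_lin_in_lin by (intro s_in)
next
  case (t_lin_in_star \<Gamma> \<Gamma>1 \<Gamma>2 x T y P P' z)
  have "svar \<Gamma>1 x (Ch Unr Recv T (star Recv T))" "qual_ctx Lin \<Gamma>"
    using t_lin_in_star.hyps by (simp_all only: star_code' qual_ctx_def qual_ty.simps) simp
  then show ?case using t_lin_in_star by (intro s_in)
next
  case t_un_in
  then show ?case by (intro s_in)
next
  case t_out_lin
  then show ?case by (intro s_out)
next
  case (t_out_star \<Gamma>12 \<Gamma>1 \<Gamma>2 \<Gamma> \<Gamma>3 x T v P P' z)
  have "svar \<Gamma>1 x (Ch Unr Send T (star Send T))"
    using t_out_star.hyps by (simp only: star_code')
  then show ?case using t_out_star by (intro s_out)
qed

text \<open>\<open>transl_ty l x T V\<close>: relative to \<open>l\<close> and \<open>x\<close>, the type \<open>T\<close> translates to \<open>V\<close>. It is a relation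
  because the auxiliary names \<open>a\<close> standing for the payloads, and hence their levels, are not
  determined by \<open>T\<close>.\<close>

inductive transl_ty :: "(name \<Rightarrow> nat) \<Rightarrow> name \<Rightarrow> sty \<Rightarrow> wty \<Rightarrow> bool" for l where
  "transl_ty l x End Unit"
| "\<lbrakk>transl_ty l a T V1; transl_ty l x S V2\<rbrakk> \<Longrightarrow> transl_ty l x (Ch Lin Recv T S) (LIn (l x) V1 V2)"
| "\<lbrakk>transl_ty l a T V1; transl_ty l x S V2\<rbrakk> \<Longrightarrow> transl_ty l x (Ch Lin Send T S) (LOut (l x) V1 V2)"
| "transl_ty l a T V \<Longrightarrow> transl_ty l x (star Recv T) (Srv (l x) V)"
| "transl_ty l a T V \<Longrightarrow> transl_ty l x (star Send T) (Cli (l x) V)"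

lemma transl_ty_dual: "transl_ty l x T V \<Longrightarrow> transl_ty l x (sdual T) (wdual V)"
  by (induction rule: transl_ty.induct)
     (auto simp: sdual_simps sdual_star intro: transl_ty.intros)

definition transl_ctx :: "(name \<Rightarrow> nat) \<Rightarrow> sctx \<Rightarrow> wctx \<Rightarrow> bool" where
  "transl_ctx l \<Gamma> \<Delta> \<longleftrightarrow> dom \<Delta> = dom \<Gamma> \<and>
     (\<forall>x T. \<Gamma> x = Some T \<longrightarrow> (\<exists>V. \<Delta> x = Some (One V) \<and> transl_ty l x T V))"


section \<open>The two classes of processes\<close>

text \<open>Processes are identified up to alpha-conversion: the rules are applied to some representative,
  whose bound names can be chosen apart from each other and from the free names. In particular, the
  level function is defined on the bound names of the representative.\<close>

definition S_procs :: "sproc set" where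
  "S_procs = {P. \<exists>P' \<Gamma>. P \<approx>\<alpha> P' \<and> \<Gamma> \<turnstile>\<^sub>s P'}"

definition W_procs :: "sproc set" where
  "W_procs = {P. \<exists>P' \<Gamma> l Q \<Delta>. P \<approx>\<alpha> P' \<and> \<Gamma> \<turnstile>\<^sub>s P' \<and>
     transl (snames P' \<union> dom \<Gamma>) \<Gamma> P' Q \<and> transl_ctx l \<Gamma> \<Delta> \<and> wtyping l \<Delta> Q}"

end

theory Submission
  imports Defs
begin

text \<open>The witness is \<open>(\<nu>xy) un x(z). y\<langle>z\<rangle>.0\<close>, a server that calls itself. It is typable with
  \<open>x : star Recv End\<close> and \<open>y : star Send End\<close>. Its translation identifies the co-variables \<open>x\<close> and
  \<open>y\<close> to one name \<open>w\<close>, which becomes the subject of an output in the body of the replicated input on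
  \<open>w\<close>; the side condition on levels then demands \<open>l w < l w\<close>.\<close>

lemma has_weight_wdual [simp]: "has_weight (wdual V) = has_weight V"
  by (cases V) auto

text \<open>An entry \<open>both V\<close> may have been justified by \<open>wdual V\<close>
  instead, but duality preserves weights.\<close>

lemma wvar_has_weight:
  assumes "wvar l \<Gamma> x V"
  shows "has_weight V (l x)"
proof -
  obtain e where e: "\<Gamma> x = Some e" "e = One V \<or> e = both V" "wctx_ok l \<Gamma>"
    using assms by cases auto
  then obtain W where "e = One W \<or> e = both W" "has_weight W (l x)"
    unfolding wctx_ok_def by blast
  with e(2) show ?thesis by (auto simp: both_def)
qed

text \<open>Only \<open>w_un_in\<close> types a replicated input. There \<open>n\<close> is the
  level of \<open>x\<close>, while names in \<open>os P\<close> have level below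
  \<open>n\<close>.\<close>

lemma wtyping_rep_not_os:
  assumes "wtyping l \<Delta> (WRep x y1 y2 P)"
  shows "x \<notin> os P"
  using assms by cases (fastforce dest: wvar_has_weight)+

text \<open>The alpha-equivalence class of the witness. Since alpha-conversion is closed under symmetry,
  each inversion is an equivalence, proved from the inversion of the next smaller subprocess.\<close>

lemma alpha_nil_iff: "P \<approx>\<alpha> Q \<Longrightarrow> P = SNil \<longleftrightarrow> Q = SNil"
  by (induction rule: alpha.induct) auto

lemma alpha_out_nil_iff: "P \<approx>\<alpha> Q \<Longrightarrow> P = SOut b c SNil \<longleftrightarrow> Q = SOut b c SNil"
  by (induction rule: alpha.induct) (auto dest: alpha_nil_iff)

text \<open>Alpha-conversion can change only the bound \<open>c\<close>. The case
  \<open>c = a\<close> is allowed because the subject \<open>a\<close> lies outside the scope of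
  \<open>c\<close>.\<close>

definition forwarder :: "name \<Rightarrow> name \<Rightarrow> sproc \<Rightarrow> bool" where
  "forwarder a b P \<longleftrightarrow> (\<exists>c. c \<noteq> b \<and> P = SIn Unr a c (SOut b c SNil))"

lemma forwarder_simps [simp]:
  "\<not> forwarder a b SNil"
  "\<not> forwarder a b (SOut x v P)"
  "\<not> forwarder a b (SPar P Q)"
  "\<not> forwarder a b (SRes x y P)"
  "forwarder a b (SIn q x y P) \<longleftrightarrow> q = Unr \<and> x = a \<and> y \<noteq> b \<and> P = SOut b y SNil"
  by (auto simp: forwarder_def)

lemma swap_name_invol [simp]: "swap_name a b (swap_name a b x) = x"
  by (simp add: swap_name_def)

lemma swap_name_eq_iff [simp]: "swap_name a b x = swap_name a b y \<longleftrightarrow> x = y"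
  by (metis swap_name_invol)

lemma sswap_nil_iff [simp]: "sswap a b P = SNil \<longleftrightarrow> P = SNil"
  by (cases P) auto

lemma sswap_out_nil_iff:
  "sswap x z P = SOut (swap_name x z b) (swap_name x z c) SNil \<longleftrightarrow> P = SOut b c SNil"
  by (cases P) auto

lemma forwarder_sswap:
  "forwarder (swap_name x z a) (swap_name x z b) (sswap x z P) \<longleftrightarrow> forwarder a b P"
  by (cases P) (auto simp: sswap_out_nil_iff)

lemma alpha_forwarder_iff: "P \<approx>\<alpha> Q \<Longrightarrow> forwarder a b P \<longleftrightarrow> forwarder a b Q"
proof (induction rule: alpha.induct)
  case (alpha_in P P' q x y)
  then show ?case by (simp add: alpha_out_nil_iff)
next
  case (alpha_in_rename z P q x y)
  \<comment> \<open>From left to right, freshness of \<open>z\<close> gives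
    \<open>z \<noteq> b\<close>. From right to left, \<open>y = b\<close> would put \<open>z\<close>
    at the subject of \<open>P\<close>, against freshness.\<close>
  have "y \<noteq> b \<and> P = SOut b y SNil \<longleftrightarrow> z \<noteq> b \<and> sswap y z P = SOut b z SNil"
    using alpha_in_rename by (cases P) (auto simp: swap_name_def)
  then show ?case by auto
qed auto

definition self_caller :: "sproc \<Rightarrow> bool" where
  "self_caller P \<longleftrightarrow> (\<exists>a b P'. a \<noteq> b \<and> forwarder a b P' \<and> P = SRes a b P')"

lemma self_caller_simps [simp]:
  "\<not> self_caller SNil"
  "\<not> self_caller (SOut x v P)"
  "\<not> self_caller (SPar P Q)"
  "\<not> self_caller (SIn q x y P)"
  "self_caller (SRes x y P) \<longleftrightarrow> x \<noteq> y \<and> forwarder x y P"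
  by (auto simp: self_caller_def)

text \<open>Needed because \<open>W_procs\<close> may choose any representative. Renaming one
  co-variable fixes the other, so \<open>forwarder_sswap\<close> applies.\<close>

lemma alpha_self_caller_iff: "P \<approx>\<alpha> Q \<Longrightarrow> self_caller P \<longleftrightarrow> self_caller Q"
proof (induction rule: alpha.induct)
  case (alpha_res P P' x y)
  then show ?case by (simp add: alpha_forwarder_iff)
next
  case (alpha_res_rename1 x y z P)
  then show ?case using forwarder_sswap[of x z x y P] by (simp add: swap_name_def)
next
  case (alpha_res_rename2 x y z P)
  then show ?case using forwarder_sswap[of y z x y P] by (auto simp: swap_name_def)
qed auto

text \<open>All contexts below the restriction are unrestricted, so each splits into two copies of
  itself, and updating a star-typed name with its own type changes nothing.\<close>

lemma self_caller_typable:
  assumes "distinct [x, y, z]"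
  shows "Map.empty \<turnstile>\<^sub>s SRes x y (SIn Unr x z (SOut y z SNil))"
proof -
  let ?R = "star Recv End" and ?S = "star Send End"
  let ?G = "[x \<mapsto> ?R, y \<mapsto> ?S]"
  let ?H = "?G(z \<mapsto> End)"
  have un: "qual_ty Unr (star p T)" for p T
    by (subst star.code) simp
  have ok: "sty_ok End" "sty_ok ?R" "sty_ok ?S"
    by (auto intro: sty_ok.intros)
  have unH: "qual_ctx Unr ?H" and unG: "qual_ctx Unr ?G"
    using un by (auto simp: qual_ctx_def simp del: qual_ty.simps(2) split: if_splits) auto
  have okH: "sctx_ok ?H" and okG: "sctx_ok ?G"
    using ok by (auto simp: sctx_ok_def split: if_splits)
  have split: "ssplit \<Gamma> \<Gamma> \<Gamma>" if "qual_ctx Unr \<Gamma>" for \<Gamma>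
    unfolding ssplit_def
  proof
    fix u show "ssplit_at (\<Gamma> u) (\<Gamma> u) (\<Gamma> u)"
      using that by (cases "\<Gamma> u") (auto simp: qual_ctx_def intro: ssplit_at.intros)
  qed
  have svar: "svar \<Gamma> u T" if "qual_ctx Unr \<Gamma>" "sctx_ok \<Gamma>" "\<Gamma> u = Some T" for \<Gamma> u T
  proof -
    have "svar ((\<Gamma>(u := None))(u \<mapsto> T)) u T"
      using that by (intro svar.intros) (auto simp: qual_ctx_def fun_upd_idem)
    with that show ?thesis by (simp add: fun_upd_idem)
  qed
  have upd: "can_update \<Gamma> u T" "\<Gamma>(u \<mapsto> T) = \<Gamma>"
    if "qual_ctx Unr \<Gamma>" "\<Gamma> u = Some T" for \<Gamma> u T
    using that by (auto simp: can_update_def qual_ctx_def)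
  have "svar ?H y ?S" "svar ?H z End" "svar ?G x ?R"
    using assms by (auto intro!: svar unH okH unG okG)
  \<comment> \<open>One unfolding exposes the prefix that the rules expect; the continuation is the
    star type again.\<close>
  then have v: "svar ?H y (Ch Unr Send End ?S)" "svar ?H z End" "svar ?G x (Ch Unr Recv End ?R)"
    by (simp_all only: star_code')
  have Hy: "?H y = Some ?S" and Gx: "?G x = Some ?R"
    using assms by auto
  have "?H(y \<mapsto> ?S) \<turnstile>\<^sub>s SNil"
    unfolding upd(2)[OF unH Hy] using unH okH by (rule s_nil)
  then have "?H \<turnstile>\<^sub>s SOut y z SNil"
    by (rule s_out[OF split[OF unH] split[OF unH] v(1,2) upd(1)[OF unH Hy]])
  then have H: "?G(x \<mapsto> ?R, z \<mapsto> End) \<turnstile>\<^sub>s SOut y z SNil"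
    unfolding upd(2)[OF unG Gx] .
  have "z \<notin> dom (?G(x \<mapsto> ?R))"
    using assms by auto
  then have "?G \<turnstile>\<^sub>s SIn Unr x z (SOut y z SNil)"
    using H by (rule s_in[OF split[OF unG] unG v(3) upd(1)[OF unG Gx]])
  then show ?thesis
    using assms by (intro s_res[where T = ?R]) (auto simp: sdual_star)
qed

text \<open>Both translations of an output keep its subject, so the type of \<open>x\<close> need
  not be determined.\<close>

lemma transl_out_cases:
  assumes "transl N \<Gamma> (SOut x v P) Q"
  obtains z P' where "z \<notin> N" "Q = WRes z (WOut x v z P')"
    | z P' where "z \<notin> N" "Q = WOut x v z P'"
  using assms by cases auto

lemma self_caller_transl:
  assumes "self_caller P" "transl N \<Gamma> P Q" "snames P \<subseteq> N"
  obtains w y1 y2 R where "Q = WRes w (WRep w y1 y2 R)" "w \<in> os R"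
proof -
  obtain a b c where ab: "a \<noteq> b" "c \<noteq> b" and P: "P = SRes a b (SIn Unr a c (SOut b c SNil))"
    using assms(1) by (auto simp: self_caller_def forwarder_def)
  have N: "{a, b, c} \<subseteq> N"
    using assms(3) P by auto
  obtain w T Q1 where Q1: "transl N (\<Gamma>(a \<mapsto> T, b \<mapsto> sdual T)) (SIn Unr a c (SOut b c SNil)) Q1"
    and Q: "Q = WRes w (wsubst w b (wsubst w a Q1))"
    using assms(2) unfolding P by cases auto
  from Q1 obtain \<Gamma>' z Q2 where "c \<noteq> a" "z \<notin> N" and Q2: "transl N \<Gamma>' (SOut b c SNil) Q2"
    and "Q1 = WRep a c z Q2"
    by cases auto
  \<comment> \<open>Both substitutions pass the binders: \<open>c\<close> differs from
    \<open>a\<close> and \<open>b\<close>, and \<open>z\<close> avoids \<open>N\<close>, which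
    contains them.\<close>
  then have "Q = WRes w (WRep w c z (wsubst w b (wsubst w a Q2)))"
    using Q ab N by (auto simp: ren_def)
  moreover have "w \<in> os (wsubst w b (wsubst w a Q2))"
    using Q2 ab N by (cases rule: transl_out_cases) (auto simp: ren_def)
  ultimately show ?thesis using that by blast
qed

lemma self_caller_notin_W_procs:
  assumes "self_caller P"
  shows "P \<notin> W_procs"
proof
  assume "P \<in> W_procs"
  then obtain P' \<Gamma> l Q \<Delta> where P': "P \<approx>\<alpha> P'" "transl (snames P' \<union> dom \<Gamma>) \<Gamma> P' Q"
    and Q: "wtyping l \<Delta> Q"
    by (auto simp: W_procs_def)
  from P' assms have "self_caller P'" by (simp add: alpha_self_caller_iff)
  then obtain w y1 y2 R where R: "Q = WRes w (WRep w y1 y2 R)" "w \<in> os R"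
    using P'(2) by (rule self_caller_transl) auto
  from Q obtain \<Delta>' where "wtyping l \<Delta>' (WRep w y1 y2 R)"
    unfolding R(1) by cases
  with R(2) show False by (auto dest: wtyping_rep_not_os)
qed

theorem mainTheorem6:
  shows "W_procs \<subset> S_procs"
proof
  show "W_procs \<subseteq> S_procs"
    by (auto simp: W_procs_def S_procs_def)
  let ?P = "SRes 0 1 (SIn Unr 0 2 (SOut 1 2 SNil))"
  have "?P \<in> S_procs"
    using self_caller_typable[of 0 1 2] alpha_refl unfolding S_procs_def by fastforce
  moreover have "?P \<notin> W_procs"
    by (rule self_caller_notin_W_procs) simp
  ultimately show "W_procs \<noteq> S_procs" by blast
qed

end
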